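(* Let $m\ge2$ and let $F\subseteq P_m$ be a face of the Kunz polyhedron whose Kunz subgroup is trivial, so that its Kunz poset $P$ has ground set $\mathbb Z_m$. Let $k$ be the number of atoms of $P$ and let $\rho$ be any finite presentation of $P$. Then \[ \dim F = k-\operatorname{rk}(M_\rho). \]
   Context: The Kunz polyhedron $P_m\subseteq\mathbb R^{m-1}$ (coordinates $x_1,\dots,x_{m-1}$) is defined by the (facet) inequalities $x_i+x_j\ge x_{i+j}$ for $1\le i\le j\le m-1$ with $i+j<m$, and $x_i+x_j+1\ge x_{i+j-m}$ for $1\le i\le j\le m-1$ with $i+j>m$. A face of $P_m$ is a nonempty set obtained by intersecting $P_m$ with the equality versions of some subset of these inequalities; $\dim F$ is the dimension of its affine span. The affine map $T(x)_i=mx_i+i$ maps $P_m$ bijectively onto the group cone $\mathcal C(\mathbb Z_m)=\{y\in\mathbb R^{m-1}: y_i+y_j\ge y_{i+j}\text{ for } i,j\in\mathbb Z_m\setminus\{0\},\, i+j\ne0\}$ (with convention $y_0=0$), and faces to faces. For a face $F$ of $P_m$ let $F'=T(F)$. The Kunz subgroup of $F$ is $H=\{h\in\mathbb Z_m: y_h=0\text{ for all }y\in F'\}$. When $H$ is trivial, the Kunz poset $P$ of $F$ is $\mathbb Z_m$ with $0$ the unique minimum and, for distinct nonzero $a,b$, $a\preceq b$ iff $y_a+y_{b-a}=y_b$ for all $y\in F'$. The Kunz nilsemigroup is $N=\mathbb Z_m\cup\{\infty\}$ with $\infty$ absorbing and $a\oplus b=a+b$ if $y_a+y_b=y_{a+b}$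 for all $y\in F'$, and $\infty$ otherwise (this is a commutative, associative operation with identity $0$). The atoms $p_1,\dots,p_k$ of $P$ are the elements covering $0$. For $u\in N$, $\mathsf Z_P(u)=\{z\in\mathbb Z_{\ge0}^k: z_1p_1\oplus\cdots\oplus z_kp_k=u\}$ and $\varphi_P:\mathbb Z_{\ge0}^k\to N$ is $z\mapsto z_1p_1\oplus\cdots\oplus z_kp_k$; $\ker\varphi_P=\{(z,z'):\varphi_P(z)=\varphi_P(z')\}$ is a congruence on $\mathbb Z_{\ge0}^k$. A presentation of $P$ is a set obtained from a generating set (as a congruence) of $\ker\varphi_P$ by deleting all pairs $(z,z')$ with $\varphi_P(z)=\infty$. For a finite presentation $\rho$, the presentation matrix $M_\rho\in\mathbb Z^{|\rho|\times k}$ has one row $z-z'$ for each $(z,z')\in\rho$ (columns indexed by the atoms); $\operatorname{rk}$ denotes its rank (the rank of an empty matrix is $0$). *)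

theory Defs
  imports "HOL-Analysis.Analysis" "Jordan_Normal_Form.DL_Rank"
begin

(* The symbol $ is reserved for coordinates in real ^ 'n; entries of the vectors from
   Jordan_Normal_Form.Matrix are written vec_index v i, with i starting at 0. *)
no_notation vec_index (infixl "$" 100)

text \<open>
  Conventions. The group Z/m is {..<m} with addition modulo m. The space of dimension m - 1 is
  real ^ 'n, and its coordinates are labelled 1, ..., m - 1 by a bijection e from {1..<m} to
  the index type 'n; so the i-th coordinate of x is x $ e i. In particular CARD('n) = m - 1.
\<close>

definition kunz_ineqs :: "nat \<Rightarrow> (nat \<times> nat) set" where
  "kunz_ineqs m = {(i, j). 1 \<le> i \<and> i \<le> j \<and> j \<le> m - 1 \<and> i + j \<noteq> m}"

fun kunz_slack :: "nat \<Rightarrow> (nat \<Rightarrow> 'n) \<Rightarrow> real ^ 'n \<Rightarrow> nat \<times> nat \<Rightarrow> real" where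
  "kunz_slack m e x (i, j) =
     (if i + j < m then x $ e i + x $ e j - x $ e (i + j)
      else x $ e i + x $ e j + 1 - x $ e (i + j - m))"

definition kunz_polyhedron :: "nat \<Rightarrow> (nat \<Rightarrow> 'n) \<Rightarrow> (real ^ 'n) set" where
  "kunz_polyhedron m e = {x. \<forall>q \<in> kunz_ineqs m. kunz_slack m e x q \<ge> 0}"

definition is_kunz_face :: "nat \<Rightarrow> (nat \<Rightarrow> 'n) \<Rightarrow> (real ^ 'n) set \<Rightarrow> bool" where
  "is_kunz_face m e F \<longleftrightarrow>
     F \<noteq> {} \<and>
     (\<exists>S \<subseteq> kunz_ineqs m. F = kunz_polyhedron m e \<inter> {x. \<forall>q \<in> S. kunz_slack m e x q = 0})"

definition kunz_T :: "nat \<Rightarrow> (nat \<Rightarrow> 'n) \<Rightarrow> real ^ 'n \<Rightarrow> real ^ 'n" where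
  "kunz_T m e x = (\<chi> j. real m * x $ j + real (inv_into {1..<m} e j))"

text \<open>Coordinates indexed by all of Z/m, with the convention that the coordinate at 0 is 0.\<close>

definition gcoord :: "(nat \<Rightarrow> 'n) \<Rightarrow> real ^ 'n \<Rightarrow> nat \<Rightarrow> real" where
  "gcoord e y i = (if i = 0 then 0 else y $ e i)"

definition kunz_subgroup :: "nat \<Rightarrow> (nat \<Rightarrow> 'n) \<Rightarrow> (real ^ 'n) set \<Rightarrow> nat set" where
  "kunz_subgroup m e F = {h \<in> {..<m}. \<forall>y \<in> kunz_T m e ` F. gcoord e y h = 0}"

text \<open>
  The Kunz poset, for a face with trivial Kunz subgroup. The term (b + m - a) mod m is
  the difference b - a in Z/m.
\<close>

definition kunz_le :: "nat \<Rightarrow> (nat \<Rightarrow> 'n) \<Rightarrow> (real ^ 'n) set \<Rightarrow> nat \<Rightarrow> nat \<Rightarrow> bool" where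
  "kunz_le m e F a b \<longleftrightarrow>
     a < m \<and> b < m \<and>
     (a = 0 \<or> a = b \<or>
      (b \<noteq> 0 \<and>
       (\<forall>y \<in> kunz_T m e ` F. gcoord e y a + gcoord e y ((b + m - a) mod m) = gcoord e y b)))"

definition kunz_less :: "nat \<Rightarrow> (nat \<Rightarrow> 'n) \<Rightarrow> (real ^ 'n) set \<Rightarrow> nat \<Rightarrow> nat \<Rightarrow> bool" where
  "kunz_less m e F a b \<longleftrightarrow> kunz_le m e F a b \<and> a \<noteq> b"

definition kunz_atoms :: "nat \<Rightarrow> (nat \<Rightarrow> 'n) \<Rightarrow> (real ^ 'n) set \<Rightarrow> nat set" where
  "kunz_atoms m e F =
     {p. kunz_less m e F 0 p \<and> \<not> (\<exists>c. kunz_less m e F 0 c \<and> kunz_less m e F c p)}"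

text \<open>The Kunz nilsemigroup; None is the absorbing element.\<close>

fun kunz_oplus ::
  "nat \<Rightarrow> (nat \<Rightarrow> 'n) \<Rightarrow> (real ^ 'n) set \<Rightarrow> nat option \<Rightarrow> nat option \<Rightarrow> nat option" where
  "kunz_oplus m e F (Some a) (Some b) =
     (if \<forall>y \<in> kunz_T m e ` F. gcoord e y a + gcoord e y b = gcoord e y ((a + b) mod m)
      then Some ((a + b) mod m) else None)"
| "kunz_oplus m e F None v = None"
| "kunz_oplus m e F u None = None"

definition kunz_nilsemigroup ::
  "nat \<Rightarrow> (nat \<Rightarrow> 'n) \<Rightarrow> (real ^ 'n) set \<Rightarrow> nat option monoid" where
  "kunz_nilsemigroup m e F =
     \<lparr>carrier = insert None (Some ` {..<m}), mult = kunz_oplus m e F, one = Some 0\<rparr>"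

text \<open>
  Below, ps is a list enumerating the atoms, k = length ps, and the exponent vectors
  are the elements of carrier_vec k over nat.
\<close>

definition factor_hom ::
  "nat \<Rightarrow> (nat \<Rightarrow> 'n) \<Rightarrow> (real ^ 'n) set \<Rightarrow> nat list \<Rightarrow> nat Matrix.vec \<Rightarrow> nat option" where
  "factor_hom m e F ps z =
     finprod (kunz_nilsemigroup m e F)
       (\<lambda>i. Some (ps ! i) [^]\<^bsub>kunz_nilsemigroup m e F\<^esub> vec_index z i) {..<length ps}"

definition factor_ker ::
  "nat \<Rightarrow> (nat \<Rightarrow> 'n) \<Rightarrow> (real ^ 'n) set \<Rightarrow> nat list \<Rightarrow> (nat Matrix.vec \<times> nat Matrix.vec) set" where
  "factor_ker m e F ps =
     {(z, z'). z \<in> carrier_vec (length ps) \<and> z' \<in> carrier_vec (length ps) \<and>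
               factor_hom m e F ps z = factor_hom m e F ps z'}"

definition is_congruence :: "nat \<Rightarrow> (nat Matrix.vec \<times> nat Matrix.vec) set \<Rightarrow> bool" where
  "is_congruence k C \<longleftrightarrow>
     equiv (carrier_vec k) C \<and>
     (\<forall>(z, z') \<in> C. \<forall>w \<in> carrier_vec k. (z + w, z' + w) \<in> C)"

definition generated_congruence ::
  "nat \<Rightarrow> (nat Matrix.vec \<times> nat Matrix.vec) set \<Rightarrow> (nat Matrix.vec \<times> nat Matrix.vec) set" where
  "generated_congruence k R = \<Inter> {C. is_congruence k C \<and> R \<subseteq> C}"

definition is_presentation ::
  "nat \<Rightarrow> (nat \<Rightarrow> 'n) \<Rightarrow> (real ^ 'n) set \<Rightarrow> nat list \<Rightarrow> (nat Matrix.vec \<times> nat Matrix.vec) set \<Rightarrow> bool"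
  where
  "is_presentation m e F ps \<rho> \<longleftrightarrow>
     (\<exists>R \<subseteq> factor_ker m e F ps.
        generated_congruence (length ps) R = factor_ker m e F ps \<and>
        \<rho> = {(z, z') \<in> R. factor_hom m e F ps z \<noteq> None})"

text \<open>The list rs enumerates the pairs of a finite presentation and thereby orders the rows.\<close>

definition presentation_matrix :: "nat \<Rightarrow> (nat Matrix.vec \<times> nat Matrix.vec) list \<Rightarrow> int Matrix.mat" where
  "presentation_matrix k rs =
     Matrix.mat (length rs) k
       (\<lambda>(i, j). int (vec_index (fst (rs ! i)) j) - int (vec_index (snd (rs ! i)) j))"

definition int_mat_rank :: "int Matrix.mat \<Rightarrow> nat" where
  "int_mat_rank A = vec_space.rank (dim_row A) (map_mat real_of_int A)"

end

theory Submission
  imports Defs "Jordan_Normal_Form.Matrix_Kernel"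
begin

no_notation vec_index (infixl "$" 100)

text \<open>
  Since the inequalities not tight on \<open>F\<close> are strict at some point of \<open>F\<close>, the affine hull of \<open>F\<close> is
  a translate of the linear space of functions on Z/m that are additive along all sums defined in
  the nilsemigroup. Restricting such a function to the atoms gives a vector in the kernel of the
  presentation matrix. This is injective because the atoms generate the nilsemigroup. It is
  surjective because, for a kernel vector \<open>v\<close>, the pairs \<open>(z, z')\<close> in the kernel congruence that map to
  infinity or satisfy \<open>v \<bullet> z = v \<bullet> z'\<close> form a congruence containing the generators, so that
  \<open>v \<bullet> z\<close> depends only on the element factored by \<open>z\<close>. Conclude by rank-nullity.
\<close>

section \<open>Rank and kernel\<close>

text \<open>Rank-nullity for the linear map \<open>v \<mapsto> A *\<^sub>v v\<close>: its kernel is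
  \<open>mat_kernel A\<close>, and its image is the column space, whose dimension is the
  rank.\<close>

lemma rank_add_kernel_dim:
  fixes A :: "'a :: field mat"
  assumes A: "A \<in> carrier_mat nr nc"
  shows "vec_space.rank nr A + kernel_dim A = nc"
proof -
  interpret kernel nr nc A by unfold_locales (rule A)
  interpret R: vec_space "TYPE('a)" nr .
  interpret T: linear_map class_ring NC.V R.V "\<lambda>v. A *\<^sub>v v"
    using A by unfold_locales
      (auto simp: LinearCombinations.module_hom_def module_vec_simps class_ring_simps
        mult_add_distrib_mat_vec mult_mat_vec)
  have ker: "T.kerT = mat_kernel A"
    using A by (auto simp: T.ker_def mat_kernel[OF A] module_vec_simps)
  have im: "T.imT = R.col_space A"
    using R.col_space_eq[OF A] carrier_matD[OF A] by (auto simp: T.im_def module_vec_simps image_iff intro!: carrier_vecI)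
  have "vectorspace.dim class_ring (R.vs T.imT) = R.rank A"
    by (simp add: im R.rank_def R.col_space_def)
  moreover have "vectorspace.dim class_ring (NC.vs T.kerT) = kernel_dim A"
    by (simp add: ker)
  ultimately show ?thesis
    using T.rank_nullity[OF NC.fin_dim] NC.dim_is_n by simp
qed

text \<open>Links the dimension of a Euclidean subspace with that of a matrix kernel: the linear
  bijection \<open>f\<close> carries a basis \<open>B\<close> of \<open>V\<close> to a basis of the
  kernel.\<close>

lemma kernel_dim_eq_dim:
  fixes V :: "'a :: euclidean_space set" and f :: "'a \<Rightarrow> real Matrix.vec"
  assumes A: "A \<in> carrier_mat nr nc" and V: "Real_Vector_Spaces.subspace V"
    and bij: "bij_betw f V (mat_kernel A)"
    and add: "\<And>x y. x \<in> V \<Longrightarrow> y \<in> V \<Longrightarrow> f (x + y) = f x + f y"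
    and scale: "\<And>c x. x \<in> V \<Longrightarrow> f (c *\<^sub>R x) = c \<cdot>\<^sub>v f x"
  shows "kernel_dim A = Real_Vector_Spaces.dim V"
proof -
  interpret kernel nr nc A by unfold_locales (rule A)
  obtain B where B: "B \<subseteq> V" "independent B" "V \<subseteq> Real_Vector_Spaces.span B"
      "card B = Real_Vector_Spaces.dim V"
    using basis_exists by blast
  have fin: "finite B" using B(2) independent_imp_finite by blast
  have fB: "f ` B \<subseteq> mat_kernel A" using B(1) bij by (auto simp: bij_betw_def)
  have inj: "inj_on f V" using bij by (simp add: bij_betw_def)
  have injB: "inj_on f B" using inj B(1) inj_on_subset by blast
  have f_carrier: "f x \<in> carrier_vec nc" if "x \<in> V" for x
    using bij that mat_kernel_carrier[OF A] by (auto simp: bij_betw_def)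
  have f0: "f 0 = 0\<^sub>v nc"
    using scale[of 0 0] f_carrier[of 0] subspace_0[OF V] by auto
  \<comment> \<open>Linearity of \<open>f\<close> is known on \<open>V\<close> only, so linear
    combinations are compared entry by entry, by induction on \<open>C\<close>. On the image side
    the coefficients are indexed by vectors of the kernel, hence the inverse of \<open>f\<close> on
    \<open>B\<close>.\<close>
  have f_sum: "f (\<Sum>b\<in>C. c b *\<^sub>R b) = lincomb (c \<circ> the_inv_into B f) (f ` C)" if "C \<subseteq> B" for c C
  proof -
    have finC: "finite C" using that fin finite_subset by blast
    have injC: "inj_on f C" using injB that inj_on_subset by blast
    have ix: "vec_index (f (\<Sum>b\<in>C. c b *\<^sub>R b)) i = (\<Sum>b\<in>C. c b * vec_index (f b) i)" if i: "i < nc" for i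
      using finC \<open>C \<subseteq> B\<close>
    proof (induction C rule: finite_induct)
      case empty
      then show ?case using f0 i by simp
    next
      case (insert b C)
      have s: "(\<Sum>b\<in>C. c b *\<^sub>R b) \<in> V"
        using insert B(1) by (intro subspace_sum[OF V] subspace_scale[OF V]) auto
      have b: "b \<in> V" "c b *\<^sub>R b \<in> V"
        using insert B(1) by (auto intro: subspace_scale[OF V])
      show ?case
        using insert f_carrier[OF b(1)] f_carrier[OF s] i
        by (auto simp: add[OF b(2) s] scale[OF b(1)])
    qed
    have s: "(\<Sum>b\<in>C. c b *\<^sub>R b) \<in> V"
      using that B(1) by (intro subspace_sum[OF V] subspace_scale[OF V]) auto
    have sub: "f ` C \<subseteq> mat_kernel A" using fB that by auto
    have "vec_index (lincomb (c \<circ> the_inv_into B f) (f ` C)) i = (\<Sum>b\<in>C. c b * vec_index (f b) i)" if i: "i < nc" for i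
      using lincomb_index[OF i sub] \<open>C \<subseteq> B\<close> injB
      by (auto simp: sum.reindex[OF injC] the_inv_into_f_f subset_iff intro!: sum.cong)
    moreover have "lincomb (c \<circ> the_inv_into B f) (f ` C) \<in> carrier_vec nc"
      using Ker.lincomb_closed[OF sub] mat_kernel_carrier[OF A] by auto
    ultimately show ?thesis using f_carrier[OF s] ix by (intro eq_vecI) auto
  qed
  have "basis (f ` B)"
    unfolding Ker.basis_def
  proof (intro conjI)
    show "lin_indpt (f ` B)"
    proof (rule Ker.finite_lin_indpt2)
      fix a assume a: "lincomb a (f ` B) = 0\<^sub>v nc"
      \<comment> \<open>This puts the coefficients into the shape of \<open>f_sum\<close>;
        injectivity of \<open>f\<close> then moves the vanishing combination back to
        \<open>B\<close>.\<close>
      have "lincomb a (f ` B) = lincomb ((a \<circ> f) \<circ> the_inv_into B f) (f ` B)"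
        using fB injB by (intro Ker.lincomb_cong) (auto simp: the_inv_into_f_f)
      then have "f (\<Sum>b\<in>B. (a \<circ> f) b *\<^sub>R b) = f 0"
        using a f_sum[of B "a \<circ> f"] f0 by simp
      then have "(\<Sum>b\<in>B. (a \<circ> f) b *\<^sub>R b) = 0"
        using B(1) by (intro inj_onD[OF inj])
          (auto intro!: subspace_sum[OF V] subspace_scale[OF V] subspace_0[OF V])
      then have "a (f b) = 0" if "b \<in> B" for b
        using B(2) fin that independentD[of B B "a \<circ> f" b] by auto
      then show "\<forall>v\<in>f ` B. a v = 0" by simp
    qed (use fin fB in auto)
    show "span (f ` B) = mat_kernel A"
    proof
      show "span (f ` B) \<subseteq> mat_kernel A"
        using Ker.span_is_subset2[OF fB] by simp
      show "mat_kernel A \<subseteq> span (f ` B)"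
      proof
        fix v assume "v \<in> mat_kernel A"
        then obtain x where x: "x \<in> V" "v = f x" using bij by (auto simp: bij_betw_def)
        obtain c where "x = (\<Sum>b\<in>B. c b *\<^sub>R b)"
          using x(1) B(3) span_finite[OF fin] by auto
        then have "v = lincomb (c \<circ> the_inv_into B f) (f ` B)"
          using f_sum[of B c] x by simp
        then show "v \<in> span (f ` B)"
          unfolding Ker.span_def using fin by blast
      qed
    qed
  qed (use fB in auto)
  then have "Ker.dim = card (f ` B)"
    using fin by (intro Ker.dim_basis) auto
  then show ?thesis using card_image[OF injB] B(4) by simp
qed

section \<open>The Kunz nilsemigroup of a face\<close>

locale kunz_face =
  fixes m :: nat and e :: "nat \<Rightarrow> 'n :: finite" and F :: "(real ^ 'n) set"
  assumes m_ge_2: "m \<ge> 2"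
    and bij_e: "bij_betw e {1..<m} (UNIV :: 'n set)"
    and face: "is_kunz_face m e F"
    and trivial_subgroup: "kunz_subgroup m e F = {0}"
begin

text \<open>For \<open>a, b < m\<close>, the condition for the sum of \<open>a\<close> and
  \<open>b\<close> to be finite in the nilsemigroup.\<close>

definition tight :: "nat \<Rightarrow> nat \<Rightarrow> bool" where
  "tight a b \<longleftrightarrow>
     (\<forall>y \<in> kunz_T m e ` F. gcoord e y a + gcoord e y b = gcoord e y ((a + b) mod m))"

text \<open>The linear relations common to all points of the transformed face, imposed on an
  arbitrary function on Z/m. They force \<open>h 0 = 0\<close>, because \<open>tight 0 0\<close>
  holds.\<close>

definition additive :: "(nat \<Rightarrow> real) \<Rightarrow> bool" where
  "additive h \<longleftrightarrow> (\<forall>a<m. \<forall>b<m. tight a b \<longrightarrow> h a + h b = h ((a + b) mod m))"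

lemma additiveD: "additive h \<Longrightarrow> a < m \<Longrightarrow> b < m \<Longrightarrow> tight a b \<Longrightarrow> h a + h b = h ((a + b) mod m)"
  by (simp add: additive_def)

lemma gcoord_0 [simp]: "gcoord e y 0 = 0"
  by (simp add: gcoord_def)

lemma gcoord_add: "gcoord e (x + y) i = gcoord e x i + gcoord e y i"
  by (simp add: gcoord_def)

lemma gcoord_scaleR: "gcoord e (c *\<^sub>R x) i = c * gcoord e x i"
  by (simp add: gcoord_def)

lemma gcoord_zero: "gcoord e 0 i = 0"
  by (simp add: gcoord_def)

section \<open>The affine map to the group cone and the facet slacks\<close>

lemma gcoord_kunz_T:
  assumes "i < m"
  shows "gcoord e (kunz_T m e x) i = (if i = 0 then 0 else real m * x $ e i + real i)"
proof -
  have "inv_into {1..<m} e (e i) = i" if "i \<noteq> 0"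
    using that assms bij_e by (intro inv_into_f_f) (auto simp: bij_betw_def)
  then show ?thesis by (simp add: gcoord_def kunz_T_def)
qed

lemma kunz_ineqsD:
  assumes "(i, j) \<in> kunz_ineqs m"
  shows "0 < i" "i < m" "0 < j" "j < m" "i + j \<noteq> m"
  using assms m_ge_2 by (auto simp: kunz_ineqs_def)

lemma finite_kunz_ineqs: "finite (kunz_ineqs m)"
  by (rule finite_subset[of _ "{..<m} \<times> {..<m}"]) (use kunz_ineqsD in auto)

lemma mod_eq_sub: "m \<le> k \<Longrightarrow> k < 2 * m \<Longrightarrow> k mod m = k - m" for k :: nat
  by (simp add: mod_if)

text \<open>When \<open>i + j\<close> wraps around, the shifts in \<open>kunz_T\<close> contribute
  \<open>i + j - (i + j - m) = m\<close>, which matches the constant 1 in the slack.\<close>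

lemma kunz_slack_kunz_T:
  assumes "(i, j) \<in> kunz_ineqs m"
  shows "gcoord e (kunz_T m e x) i + gcoord e (kunz_T m e x) j - gcoord e (kunz_T m e x) ((i + j) mod m)
    = real m * kunz_slack m e x (i, j)"
proof (cases "i + j < m")
  case True
  then show ?thesis using kunz_ineqsD[OF assms] by (simp add: gcoord_kunz_T algebra_simps)
next
  case False
  then have "(i + j) mod m = i + j - m" "i + j - m < m" "i + j - m \<noteq> 0"
    using kunz_ineqsD[OF assms] by (auto simp: mod_eq_sub)
  then show ?thesis
    using kunz_ineqsD[OF assms] False by (simp add: gcoord_kunz_T algebra_simps of_nat_diff)
qed

text \<open>A slack is affine in \<open>x\<close>. The constant 1 disappears from its linear part,
  so both cases of the slack merge into one expression modulo \<open>m\<close>.\<close>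

lemma kunz_slack_add:
  assumes "(i, j) \<in> kunz_ineqs m"
  shows "kunz_slack m e (x + d) (i, j)
    = kunz_slack m e x (i, j) + (gcoord e d i + gcoord e d j - gcoord e d ((i + j) mod m))"
proof (cases "i + j < m")
  case True
  then show ?thesis using kunz_ineqsD[OF assms] by (simp add: gcoord_def)
next
  case False
  then have "(i + j) mod m = i + j - m" "i + j - m \<noteq> 0"
    using kunz_ineqsD[OF assms] by (auto simp: mod_eq_sub)
  then show ?thesis
    using kunz_ineqsD[OF assms] False by (simp add: gcoord_def)
qed

lemma face_nonempty: "F \<noteq> {}"
  using face by (simp add: is_kunz_face_def)

lemma kunz_slack_nonneg: "x \<in> F \<Longrightarrow> q \<in> kunz_ineqs m \<Longrightarrow> kunz_slack m e x q \<ge> 0"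
  using face by (auto simp: is_kunz_face_def kunz_polyhedron_def)

text \<open>A face is cut out by all the inequalities that are tight on it, whichever set
  \<open>S\<close> was used to define it, since \<open>S\<close> consists of such
  inequalities.\<close>

lemma face_memI:
  assumes "\<And>q. q \<in> kunz_ineqs m \<Longrightarrow> kunz_slack m e x q \<ge> 0"
    and "\<And>q. q \<in> kunz_ineqs m \<Longrightarrow> \<forall>x'\<in>F. kunz_slack m e x' q = 0 \<Longrightarrow> kunz_slack m e x q = 0"
  shows "x \<in> F"
proof -
  obtain S where S: "S \<subseteq> kunz_ineqs m"
      "F = kunz_polyhedron m e \<inter> {x. \<forall>q \<in> S. kunz_slack m e x q = 0}"
    using face by (auto simp: is_kunz_face_def)
  then have "kunz_slack m e x q = 0" if "q \<in> S" for q
    using that assms(2)[of q] by blast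
  then show ?thesis using S(2) assms(1) by (simp add: kunz_polyhedron_def)
qed

lemma tight_iff_slack:
  assumes "(i, j) \<in> kunz_ineqs m"
  shows "tight i j \<longleftrightarrow> (\<forall>x\<in>F. kunz_slack m e x (i, j) = 0)"
proof -
  have "gcoord e (kunz_T m e x) i + gcoord e (kunz_T m e x) j = gcoord e (kunz_T m e x) ((i + j) mod m)
      \<longleftrightarrow> kunz_slack m e x (i, j) = 0" for x
    using kunz_slack_kunz_T[OF assms, of x] m_ge_2 by (auto simp: algebra_simps)
  then show ?thesis by (simp add: tight_def)
qed

lemma tight_commute: "tight a b \<longleftrightarrow> tight b a"
  by (simp add: tight_def add.commute)

lemma tight_0_left [simp]: "a < m \<Longrightarrow> tight 0 a"
  by (simp add: tight_def)

lemma tight_0_right [simp]: "a < m \<Longrightarrow> tight a 0"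
  by (simp add: tight_def)

section \<open>Subadditivity and its consequences on the transformed face\<close>

lemma subadditive:
  assumes "y \<in> kunz_T m e ` F" "0 < a" "a < m" "0 < b" "b < m" "(a + b) mod m \<noteq> 0"
  shows "gcoord e y a + gcoord e y b \<ge> gcoord e y ((a + b) mod m)"
proof -
  obtain x where x: "x \<in> F" "y = kunz_T m e x" using assms(1) by blast
  have *: "gcoord e y i + gcoord e y j \<ge> gcoord e y ((i + j) mod m)" if "(i, j) \<in> kunz_ineqs m" for i j
  proof -
    have "real m * kunz_slack m e x (i, j) \<ge> 0"
      using kunz_slack_nonneg[OF x(1) that] by simp
    then show ?thesis using kunz_slack_kunz_T[OF that, of x] unfolding x(2) by linarith
  qed
  have "a + b \<noteq> m" using assms(6) by auto
  then show ?thesis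
    using assms *[of a b] *[of b a] by (cases "a \<le> b") (auto simp: kunz_ineqs_def add.commute)
qed

lemma diff_mod:
  assumes "a < m" "c < m"
  shows "(a + (c + m - a) mod m) mod m = c"
proof -
  have "(a + (c + m - a) mod m) mod m = (a + (c + m - a)) mod m" by (rule mod_add_right_eq)
  then show ?thesis using assms by simp
qed

text \<open>Write \<open>y b\<close> for the coordinate at \<open>b\<close>, and let
  \<open>c\<close> be a nonzero index where it is largest. For nonzero \<open>b \<noteq> c\<close>,
  \<open>y b + y (c - b) \<ge> y c \<ge> y (c - b)\<close> gives \<open>y b \<ge> 0\<close>. The
  largest coordinate dominates such a \<open>y b\<close>, and some such \<open>b\<close> exists
  because \<open>m \<ge> 3\<close>.\<close>

lemma gcoord_nonneg:
  assumes "m \<ge> 3" "y \<in> kunz_T m e ` F" "a < m"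
  shows "gcoord e y a \<ge> 0"
proof -
  obtain c where c: "c \<in> {1..<m}" "\<And>i. i \<in> {1..<m} \<Longrightarrow> gcoord e y i \<le> gcoord e y c"
  proof -
    have "finite {1..<m}" "{1..<m} \<noteq> {}" using m_ge_2 by auto
    then have "Max (gcoord e y ` {1..<m}) \<in> gcoord e y ` {1..<m}" by (intro Max_in) auto
    then obtain c where "c \<in> {1..<m}" "gcoord e y c = Max (gcoord e y ` {1..<m})" by auto
    then show ?thesis using that by simp
  qed
  have *: "gcoord e y b \<ge> 0" if b: "b \<in> {1..<m}" "b \<noteq> c" for b
  proof -
    define d where "d = (c + m - b) mod m"
    have bd: "(b + d) mod m = c" unfolding d_def using b c by (intro diff_mod) auto
    have "d < m" using m_ge_2 by (simp add: d_def)
    moreover have "d \<noteq> 0"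
      using bd b by (cases "d = 0") auto
    ultimately have "gcoord e y b + gcoord e y d \<ge> gcoord e y c" "gcoord e y d \<le> gcoord e y c"
      using subadditive[OF assms(2), of b d] b c bd by auto
    then show ?thesis by linarith
  qed
  obtain b where b: "b \<in> {1..<m}" "b \<noteq> c"
  proof (cases "c = 1")
    case True then show ?thesis using that[of 2] assms(1) by auto
  next
    case False then show ?thesis using that[of 1] assms(1) by auto
  qed
  then have "gcoord e y c \<ge> 0" using *[OF b] c(2)[OF b(1)] by linarith
  then show ?thesis using *[of a] assms(3) by (cases "a = 0"; cases "a = c") auto
qed

lemma eq_0_if_gcoord_eq_0:
  assumes "a < m" "\<And>y. y \<in> kunz_T m e ` F \<Longrightarrow> gcoord e y a = 0"
  shows "a = 0"
proof -
  have "a \<in> kunz_subgroup m e F" using assms by (simp add: kunz_subgroup_def)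
  then show ?thesis using trivial_subgroup by simp
qed

text \<open>For \<open>m = 2\<close> the elements coincide, so twice the coordinate vanishes on the
  face; for \<open>m \<ge> 3\<close> two nonnegative coordinates have sum zero. Either way both
  elements lie in the trivial Kunz subgroup.\<close>

lemma tight_inverse:
  assumes "tight a b" "(a + b) mod m = 0" "a < m" "b < m"
  shows "a = 0 \<and> b = 0"
proof -
  have sum: "gcoord e y a + gcoord e y b = 0" if "y \<in> kunz_T m e ` F" for y
    using assms that by (auto simp: tight_def)
  show ?thesis
  proof (cases "m = 2")
    case True
    then have "a = b" using assms by (cases "a = 0"; cases "b = 0") (auto simp: less_2_cases_iff)
    then have "gcoord e y a = 0" if "y \<in> kunz_T m e ` F" for y using sum[OF that] by simp
    then have "a = 0" using assms(3) by (intro eq_0_if_gcoord_eq_0)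
    then show ?thesis using \<open>a = b\<close> by simp
  next
    case False
    then have "m \<ge> 3" using m_ge_2 by simp
    then have "gcoord e y a = 0 \<and> gcoord e y b = 0" if "y \<in> kunz_T m e ` F" for y
      using sum[OF that] gcoord_nonneg[of y a] gcoord_nonneg[of y b] that assms by fastforce
    then show ?thesis using eq_0_if_gcoord_eq_0 assms by blast
  qed
qed

text \<open>Pairs with \<open>a + b = m\<close> carry no inequality, but
  \<open>tight_inverse\<close> shows that they are never tight.\<close>

lemma tight_kunz_ineqs:
  assumes "tight a b" "0 < a" "a < m" "0 < b" "b < m"
  shows "(min a b, max a b) \<in> kunz_ineqs m"
proof -
  have "a + b \<noteq> m" using tight_inverse[OF assms(1)] assms by auto
  then show ?thesis using assms by (auto simp: kunz_ineqs_def min_def max_def)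
qed

text \<open>With \<open>t = b + c\<close> and \<open>r = a + b + c\<close> in Z/m,
  \<open>y r = y a + y b + y c \<ge> y a + y t \<ge> y r\<close> by subadditivity, so equality holds
  throughout. Subadditivity applies only once \<open>t\<close> and \<open>r\<close> are known to be
  nonzero.\<close>

lemma tight_assoc:
  assumes "tight a b" "tight ((a + b) mod m) c" "a < m" "b < m" "c < m"
  shows "tight b c" "tight a ((b + c) mod m)"
proof -
  have "tight b c \<and> tight a ((b + c) mod m)"
  proof (cases "a = 0 \<or> b = 0 \<or> c = 0")
    case True
    then show ?thesis using assms by auto
  next
    case False
    define s where "s = (a + b) mod m"
    define t where "t = (b + c) mod m"
    define r where "r = (s + c) mod m"
    have r: "r = (a + t) mod m"
      by (simp add: r_def s_def t_def mod_simps add.assoc)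
    have lt: "s < m" "t < m" using m_ge_2 by (auto simp: s_def t_def)
    have r0: "r \<noteq> 0"
      using tight_inverse[of s c] assms False lt by (auto simp: r_def s_def)
    have sum: "gcoord e y a + gcoord e y b + gcoord e y c = gcoord e y r"
      if "y \<in> kunz_T m e ` F" for y
      using assms that by (auto simp: tight_def r_def s_def)
    \<comment> \<open>If \<open>t = 0\<close> then \<open>r = a\<close>, and the triple sum reduces
      to \<open>y b + y c = 0\<close>, making \<open>b\<close> and \<open>c\<close> a tight inverse
      pair.\<close>
    have t0: "t \<noteq> 0"
    proof
      assume "t = 0"
      then have "r = a" using r assms by simp
      then have "tight b c"
        using sum \<open>t = 0\<close> unfolding tight_def t_def[symmetric] by fastforce
      then show False using tight_inverse[of b c] \<open>t = 0\<close> assms False by (simp add: t_def)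
    qed
    have "gcoord e y b + gcoord e y c = gcoord e y t \<and> gcoord e y a + gcoord e y t = gcoord e y r"
      if y: "y \<in> kunz_T m e ` F" for y
      using sum[OF y] subadditive[OF y, of b c] subadditive[OF y, of a t] False assms lt r0 t0
      by (simp add: r t_def[symmetric])
    then show ?thesis by (simp add: tight_def t_def[symmetric] r[symmetric])
  qed
  then show "tight b c" "tight a ((b + c) mod m)" by auto
qed

section \<open>The nilsemigroup as a commutative monoid\<close>

lemma kunz_oplus_Some:
  "kunz_oplus m e F (Some a) (Some b) = (if tight a b then Some ((a + b) mod m) else None)"
  by (simp add: tight_def)

lemma kunz_oplus_commute: "kunz_oplus m e F u v = kunz_oplus m e F v u"
  by (cases u; cases v) (auto simp: kunz_oplus_Some tight_commute add.commute simp del: kunz_oplus.simps(1))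

sublocale N: comm_monoid "kunz_nilsemigroup m e F"
proof (rule comm_monoidI; unfold kunz_nilsemigroup_def monoid.simps partial_object.simps)
  let ?M = "insert None (Some ` {..<m})"
  let ?p = "kunz_oplus m e F"
  show "?p u v \<in> ?M" if "u \<in> ?M" "v \<in> ?M" for u v
    using that m_ge_2 by (auto simp: kunz_oplus_Some simp del: kunz_oplus.simps(1))
  show "Some 0 \<in> ?M" using m_ge_2 by auto
  show "?p (?p u v) w = ?p u (?p v w)" if "u \<in> ?M" "v \<in> ?M" "w \<in> ?M" for u v w
  proof -
    consider "u = None" | "v = None" | "w = None"
      | a b c where "u = Some a" "v = Some b" "w = Some c" "a < m" "b < m" "c < m"
      using \<open>u \<in> ?M\<close> \<open>v \<in> ?M\<close> \<open>w \<in> ?M\<close> by auto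
    then show ?thesis
    proof cases
      case 4
      \<comment> \<open>Both bracketings are finite under the same condition; the converse is
        \<open>tight_assoc\<close> read from right to left.\<close>
      have "tight a b \<and> tight ((a + b) mod m) c \<longleftrightarrow> tight b c \<and> tight a ((b + c) mod m)"
        using tight_assoc[of a b c] tight_assoc[of c b a] 4
        by (metis tight_commute add.commute)
      then show ?thesis
        using 4 by (auto simp: kunz_oplus_Some mod_simps add.assoc simp del: kunz_oplus.simps(1))
    qed (auto simp: kunz_oplus_commute[of _ None] simp del: kunz_oplus.simps(1))
  qed
  show "?p (Some 0) u = u" if "u \<in> ?M" for u
    using that by (auto simp: kunz_oplus_Some simp del: kunz_oplus.simps(1))
  show "?p u v = ?p v u" for u v
    by (rule kunz_oplus_commute)
qed

lemma carrier_N: "carrier (kunz_nilsemigroup m e F) = insert None (Some ` {..<m})"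
  by (simp add: kunz_nilsemigroup_def)

lemma one_N: "\<one>\<^bsub>kunz_nilsemigroup m e F\<^esub> = Some 0"
  by (simp add: kunz_nilsemigroup_def)

lemma mult_N: "u \<otimes>\<^bsub>kunz_nilsemigroup m e F\<^esub> v = kunz_oplus m e F u v"
  by (simp add: kunz_nilsemigroup_def)

lemma mult_N_eq_SomeD:
  assumes "u \<otimes>\<^bsub>kunz_nilsemigroup m e F\<^esub> v = Some c"
  obtains a b where "u = Some a" "v = Some b" "tight a b" "c = (a + b) mod m"
  using assms
  by (cases u; cases v) (auto simp: mult_N kunz_oplus_Some split: if_splits simp del: kunz_oplus.simps(1))

text \<open>The case \<open>m = 2\<close> is separate because then the polyhedron is the whole line and coordinates
  may be negative. Otherwise the height is a sum of points of the face, one per element.\<close>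
lemma exists_height:
  obtains f where "additive f" "\<And>u. 0 < u \<Longrightarrow> u < m \<Longrightarrow> f u > 0"
proof (cases "m = 2")
  case True
  have "additive real"
    unfolding additive_def
  proof (intro allI impI)
    fix a b assume ab: "a < m" "b < m" "tight a b"
    \<comment> \<open>The only sum that wraps around is \<open>1 + 1\<close>, and it is not tight,
      so the identity is additive.\<close>
    have "\<not> (a = 1 \<and> b = 1)" using tight_inverse[of a b] ab True by auto
    then show "real a + real b = real ((a + b) mod m)"
      using ab True by (auto simp: less_2_cases_iff)
  qed
  then show ?thesis using that[of real] by simp
next
  case False
  then have m3: "m \<ge> 3" using m_ge_2 by simp
  have "\<forall>u\<in>{1..<m}. \<exists>y. y \<in> kunz_T m e ` F \<and> gcoord e y u \<noteq> 0"
    using eq_0_if_gcoord_eq_0 by fastforce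
  then obtain Y where Y: "\<And>u. u \<in> {1..<m} \<Longrightarrow> Y u \<in> kunz_T m e ` F"
      "\<And>u. u \<in> {1..<m} \<Longrightarrow> gcoord e (Y u) u \<noteq> 0"
    by metis
  define f where "f v = (\<Sum>u\<in>{1..<m}. gcoord e (Y u) v)" for v
  have "additive f"
    unfolding additive_def
  proof (intro allI impI)
    fix a b assume "tight a b"
    then have "f ((a + b) mod m) = (\<Sum>u\<in>{1..<m}. gcoord e (Y u) a + gcoord e (Y u) b)"
      using Y(1) unfolding f_def tight_def by (intro sum.cong refl) metis
    then show "f a + f b = f ((a + b) mod m)" by (simp add: f_def sum.distrib)
  qed
  moreover have "f u > 0" if "0 < u" "u < m" for u
    unfolding f_def
  proof (rule sum_pos2[of _ u])
    show "0 < gcoord e (Y u) u"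
      using gcoord_nonneg[OF m3 Y(1), of u u] Y(2)[of u] that by auto
    show "0 \<le> gcoord e (Y i) u" if "i \<in> {1..<m}" for i
      using gcoord_nonneg[OF m3 Y(1)[OF that]] \<open>u < m\<close> by simp
  qed (use that in auto)
  ultimately show ?thesis using that by blast
qed

section \<open>The affine hull of a face\<close>

text \<open>The inequalities are treated one after another, each time averaging the current point
  with a point of \<open>F\<close> where the new slack is nonzero. Slacks are affine and nonnegative
  on \<open>F\<close>, so the midpoint keeps every positive slack.\<close>

lemma exists_relative_interior_point:
  obtains x where "x \<in> F"
    "\<And>i j. (i, j) \<in> kunz_ineqs m \<Longrightarrow> \<not> tight i j \<Longrightarrow> kunz_slack m e x (i, j) > 0"
proof -
  have "\<exists>x\<in>F. \<forall>q\<in>Q. (\<exists>x'\<in>F. kunz_slack m e x' q \<noteq> 0) \<longrightarrow> kunz_slack m e x q > 0"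
    if "finite Q" "Q \<subseteq> kunz_ineqs m" for Q
    using that
  proof (induction Q rule: finite_induct)
    case empty
    then show ?case using face_nonempty by auto
  next
    case (insert q Q)
    then obtain x where x: "x \<in> F"
        "\<And>q. q \<in> Q \<Longrightarrow> (\<exists>x'\<in>F. kunz_slack m e x' q \<noteq> 0) \<Longrightarrow> kunz_slack m e x q > 0"
      by blast
    show ?case
    proof (cases "\<exists>x'\<in>F. kunz_slack m e x' q \<noteq> 0")
      case True
      then obtain x' where x': "x' \<in> F" "kunz_slack m e x' q \<noteq> 0" by blast
      \<comment> \<open>The midpoint, written as \<open>x\<close> plus a displacement to fit
        \<open>kunz_slack_add\<close>.\<close>
      define w where "w = x + (1/2) *\<^sub>R (x' - x)"
      have w: "kunz_slack m e w p = (kunz_slack m e x p + kunz_slack m e x' p) / 2"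
        if mem: "p \<in> kunz_ineqs m" for p
      proof -
        obtain i j where p: "p = (i, j)" "(i, j) \<in> kunz_ineqs m" using mem by (cases p) auto
        show ?thesis
          using kunz_slack_add[OF p(2), of x "x' - x"] kunz_slack_add[OF p(2), of x "(1/2) *\<^sub>R (x' - x)"]
          by (simp add: p(1) w_def gcoord_scaleR del: kunz_slack.simps)
      qed
      have wF: "w \<in> F"
        using kunz_slack_nonneg x x' by (intro face_memI) (auto simp: w simp del: kunz_slack.simps)
      have "kunz_slack m e w p > 0" if "p \<in> insert q Q" "\<exists>x'\<in>F. kunz_slack m e x' p \<noteq> 0" for p
      proof -
        have p: "p \<in> kunz_ineqs m" using that insert.prems by auto
        have "kunz_slack m e x p > 0 \<or> kunz_slack m e x' p > 0"
          using that x(2) x' kunz_slack_nonneg[OF x'(1) p] by (cases "p = q") auto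
        then show ?thesis
          using kunz_slack_nonneg[OF x(1) p] kunz_slack_nonneg[OF x'(1) p] by (auto simp: w[OF p])
      qed
      then show ?thesis using wF by blast
    next
      case False
      then show ?thesis using x by blast
    qed
  qed
  from this[OF finite_kunz_ineqs order_refl] show ?thesis
    using that tight_iff_slack by metis
qed

text \<open>The direction space of the affine hull of \<open>F\<close>. No \<open>kunz_T\<close>
  occurs, since its linear part is a scaling by \<open>m\<close> and leaves a linear space
  unchanged.\<close>

definition directions :: "(real ^ 'n) set" where
  "directions = {d. additive (gcoord e d)}"

lemma subspace_directions: "Real_Vector_Spaces.subspace directions"
proof (rule real_vector.subspaceI)
  show "0 \<in> directions" by (simp add: directions_def additive_def gcoord_zero)
  show "x + y \<in> directions" if "x \<in> directions" "y \<in> directions" for x y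
    using that by (simp add: directions_def additive_def gcoord_add) (metis add.assoc add.left_commute)
  show "c *\<^sub>R x \<in> directions" if "x \<in> directions" for c x
    using that by (simp add: directions_def additive_def gcoord_scaleR flip: distrib_left)
qed

lemma directionsD:
  assumes "d \<in> directions" "(i, j) \<in> kunz_ineqs m" "tight i j"
  shows "gcoord e d i + gcoord e d j = gcoord e d ((i + j) mod m)"
  using assms kunz_ineqsD[OF assms(2)] by (intro additiveD) (auto simp: directions_def)

text \<open>On a tight pair the slack vanishes at both points, so its linear part vanishes on their
  difference. Pairs containing 0 are trivial, and all other tight pairs are facet inequalities up to
  order.\<close>

lemma diff_mem_directions:
  assumes "x \<in> F" "x' \<in> F"
  shows "x - x' \<in> directions"
  unfolding directions_def additive_def mem_Collect_eq
proof (intro allI impI)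
  fix a b assume ab: "a < m" "b < m" "tight a b"
  have *: "gcoord e (x - x') i + gcoord e (x - x') j = gcoord e (x - x') ((i + j) mod m)"
    if "(i, j) \<in> kunz_ineqs m" "tight i j" for i j
    using kunz_slack_add[OF that(1), of x' "x - x'"] that assms
    by (simp add: tight_iff_slack del: kunz_slack.simps)
  show "gcoord e (x - x') a + gcoord e (x - x') b = gcoord e (x - x') ((a + b) mod m)"
  proof (cases "a = 0 \<or> b = 0")
    case True
    then show ?thesis using ab by auto
  next
    case False
    then have "(min a b, max a b) \<in> kunz_ineqs m" using ab by (intro tight_kunz_ineqs) auto
    then show ?thesis
      using *[of a b] *[of b a] ab by (cases "a \<le> b") (auto simp: tight_commute add.commute)
  qed
qed

text \<open>From a relative interior point \<open>x\<close>, a small step along any direction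
  \<open>d\<close> stays in \<open>F\<close>: tight slacks do not change and the others remain
  positive by continuity. Hence \<open>x + d\<close> lies on a line through two points of
  \<open>F\<close>.\<close>

lemma aff_dim_face: "aff_dim F = int (Real_Vector_Spaces.dim directions)"
proof -
  obtain x where x: "x \<in> F"
    "\<And>i j. (i, j) \<in> kunz_ineqs m \<Longrightarrow> \<not> tight i j \<Longrightarrow> kunz_slack m e x (i, j) > 0"
    by (rule exists_relative_interior_point) blast
  have "affine hull F = (+) x ` directions"
  proof
    show "affine hull F \<subseteq> (+) x ` directions"
    proof (rule hull_minimal)
      show "F \<subseteq> (+) x ` directions"
        using diff_mem_directions[OF _ x(1)] by (force simp: image_iff)
      show "affine ((+) x ` directions)"
        using subspace_directions subspace_affine affine_translation by blast
    qed
    show "(+) x ` directions \<subseteq> affine hull F"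
    proof
      fix v assume "v \<in> (+) x ` directions"
      then obtain d where d: "d \<in> directions" "v = x + d" by blast
      \<comment> \<open>The rate of change of the slack \<open>q\<close> along
        \<open>d\<close>.\<close>
      define l where "l q = (case q of (i, j) \<Rightarrow> gcoord e d i + gcoord e d j - gcoord e d ((i + j) mod m))" for q
      have slack: "kunz_slack m e (x + t *\<^sub>R d) q = kunz_slack m e x q + t * l q"
        if "q \<in> kunz_ineqs m" for q t
        using that kunz_slack_add[of "fst q" "snd q" x "t *\<^sub>R d"]
        by (cases q) (simp add: l_def gcoord_scaleR algebra_simps del: kunz_slack.simps)
      have l0: "l q = 0" if "q \<in> kunz_ineqs m" "\<forall>x'\<in>F. kunz_slack m e x' q = 0" for q
        using that directionsD[OF d(1)] tight_iff_slack by (cases q) (auto simp: l_def simp del: kunz_slack.simps)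
      have "\<forall>\<^sub>F t in at_right 0. kunz_slack m e x q + t * l q \<ge> 0" if q: "q \<in> kunz_ineqs m" for q
      proof (cases "\<forall>x'\<in>F. kunz_slack m e x' q = 0")
        case True
        then show ?thesis using x(1) l0[OF q True] by simp
      next
        case False
        then have pos: "kunz_slack m e x q > 0" using q x(2) tight_iff_slack by (cases q) blast
        have "((\<lambda>t. kunz_slack m e x q + t * l q) \<longlongrightarrow> kunz_slack m e x q + 0 * l q) (at_right 0)"
          by (intro tendsto_intros)
        then have "\<forall>\<^sub>F t in at_right 0. kunz_slack m e x q + t * l q > 0"
          using pos by (intro order_tendstoD) auto
        then show ?thesis by (rule eventually_mono) simp
      qed
      then have "\<forall>\<^sub>F t in at_right 0. \<forall>q\<in>kunz_ineqs m. kunz_slack m e x q + t * l q \<ge> 0"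
        by (intro eventually_ball_finite finite_kunz_ineqs) blast
      then have "\<forall>\<^sub>F t in at_right 0. (\<forall>q\<in>kunz_ineqs m. kunz_slack m e x q + t * l q \<ge> 0) \<and> 0 < (t :: real)"
        using eventually_at_right_less by (rule eventually_conj)
      then obtain t where t: "\<And>q. q\<in>kunz_ineqs m \<Longrightarrow> kunz_slack m e x q + t * l q \<ge> 0" "0 < t"
        using eventually_happens'[OF trivial_limit_at_right_real] by blast
      have "x + t *\<^sub>R d \<in> F"
        using t x(1) l0 by (intro face_memI) (auto simp: slack simp del: kunz_slack.simps)
      \<comment> \<open>This affine combination of two points of \<open>F\<close> equals
        \<open>x + d\<close>.\<close>
      then have "(1 - 1 / t) *\<^sub>R x + (1 / t) *\<^sub>R (x + t *\<^sub>R d) \<in> affine hull F"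
        using x(1) by (intro mem_affine affine_affine_hull) (auto intro: hull_inc)
      then show "v \<in> affine hull F"
        using t(2) by (simp add: d(2) algebra_simps)
    qed
  qed
  then have "aff_dim F = aff_dim ((+) x ` directions)"
    by (metis aff_dim_affine_hull)
  then show ?thesis
    by (simp add: aff_dim_translation_eq aff_dim_subspace subspace_directions)
qed

end

section \<open>Factorizations\<close>

locale kunz_factorizations = kunz_face m e F
  for m and e :: "nat \<Rightarrow> 'n :: finite" and F +
  fixes ps :: "nat list"
  assumes set_ps: "set ps = kunz_atoms m e F"
begin

abbreviation "N \<equiv> kunz_nilsemigroup m e F"
abbreviation "k \<equiv> length ps"
abbreviation "\<phi> \<equiv> factor_hom m e F ps"

text \<open>The pairing of \<open>v\<close> with an exponent vector. As \<open>v\<close> is a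
  function on positions, both the entries of a vector and the values of an additive function at the
  atoms can be inserted.\<close>

definition weight :: "(nat \<Rightarrow> real) \<Rightarrow> nat Matrix.vec \<Rightarrow> real" where
  "weight v z = (\<Sum>i<k. real (vec_index z i) * v i)"

lemma weight_add:
  "z \<in> carrier_vec k \<Longrightarrow> w \<in> carrier_vec k \<Longrightarrow> weight v (z + w) = weight v z + weight v w"
  by (simp add: weight_def distrib_right sum.distrib)

lemma weight_zero: "weight v (0\<^sub>v k) = 0"
  by (simp add: weight_def)

lemma weight_unit_vec: "i < k \<Longrightarrow> weight v (unit_vec k i) = v i"
proof -
  assume "i < k"
  then have "weight v (unit_vec k i) = (\<Sum>j<k. if j = i then v j else 0)"
    unfolding weight_def by (intro sum.cong) (auto simp: unit_vec_def)
  then show ?thesis using \<open>i < k\<close> by simp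
qed

lemma atom_lt: "i < k \<Longrightarrow> ps ! i < m" "i < k \<Longrightarrow> ps ! i \<noteq> 0"
  using nth_mem[of i ps] unfolding set_ps by (auto simp: kunz_atoms_def kunz_less_def kunz_le_def)

lemma atom_carrier: "i < k \<Longrightarrow> Some (ps ! i) \<in> carrier N"
  using atom_lt by (auto simp: carrier_N)

lemma phi_closed: "\<phi> z \<in> carrier N"
  unfolding factor_hom_def by (intro N.finprod_closed) (auto intro: atom_carrier)

lemma phi_lt: "\<phi> z = Some u \<Longrightarrow> u < m"
  using phi_closed[of z] by (auto simp: carrier_N)

lemma phi_add:
  assumes "z \<in> carrier_vec k" "w \<in> carrier_vec k"
  shows "\<phi> (z + w) = \<phi> z \<otimes>\<^bsub>N\<^esub> \<phi> w"
proof -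
  have "\<phi> (z + w) = finprod N (\<lambda>i. (Some (ps ! i) [^]\<^bsub>N\<^esub> vec_index z i) \<otimes>\<^bsub>N\<^esub> (Some (ps ! i) [^]\<^bsub>N\<^esub> vec_index w i)) {..<k}"
    unfolding factor_hom_def
    using assms by (intro N.finprod_cong') (auto simp: N.nat_pow_mult atom_carrier)
  also have "\<dots> = \<phi> z \<otimes>\<^bsub>N\<^esub> \<phi> w"
    unfolding factor_hom_def by (intro N.finprod_multf) (auto intro: atom_carrier)
  finally show ?thesis .
qed

lemma phi_zero: "\<phi> (0\<^sub>v k) = Some 0"
  unfolding factor_hom_def one_N[symmetric]
  by (intro N.finprod_one_eqI) auto

lemma phi_unit_vec:
  assumes "i < k"
  shows "\<phi> (unit_vec k i) = Some (ps ! i)"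
proof -
  have "\<phi> (unit_vec k i) = finprod N (\<lambda>j. if i = j then Some (ps ! j) else \<one>\<^bsub>N\<^esub>) {..<k}"
    unfolding factor_hom_def using assms
    by (intro N.finprod_cong') (auto simp: atom_carrier)
  also have "\<dots> = Some (ps ! i)"
    using assms by (intro N.finprod_singleton) (auto simp: atom_carrier)
  finally show ?thesis .
qed

text \<open>A product that is finite has only finite partial products, because \<open>None\<close>
  absorbs. Additivity therefore applies at each multiplication, first within the powers of an atom
  and then across the atoms.\<close>

lemma phi_additive:
  assumes h: "additive h" and "\<phi> z = Some u"
  shows "h u = weight (\<lambda>i. h (ps ! i)) z"
proof -
  have h0: "h 0 = 0" using additiveD[OF h, of 0 0] m_ge_2 by simp
  have mult: "h c = h a + h b"
    if "Some a \<otimes>\<^bsub>N\<^esub> Some b = Some c" "a < m" "b < m" for a b c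
    using that additiveD[OF h] by (auto elim!: mult_N_eq_SomeD)
  have lt: "a < m" if "Some a \<in> carrier N" for a using that by (auto simp: carrier_N)
  have pow: "h c = real n * h a" if "Some a [^]\<^bsub>N\<^esub> n = Some c" "a < m" for a n c
    using that(1)
  proof (induction n arbitrary: c)
    case 0
    then show ?case using h0 by (simp add: one_N)
  next
    case (Suc n)
    have cl: "Some a [^]\<^bsub>N\<^esub> n \<in> carrier N"
      using \<open>a < m\<close> by (intro N.nat_pow_closed) (auto simp: carrier_N)
    from Suc.prems obtain b where b: "Some a [^]\<^bsub>N\<^esub> n = Some b"
      by (auto elim: mult_N_eq_SomeD)
    then show ?case
      using Suc mult[of b a c] cl lt[of b] \<open>a < m\<close> by (auto simp: algebra_simps)
  qed
  \<comment> \<open>Stated for subsets \<open>I\<close> of the positions so that induction can add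
    one atom at a time.\<close>
  have "h u = (\<Sum>i\<in>I. real (vec_index z i) * h (ps ! i))"
    if "finite I" "I \<subseteq> {..<k}"
      "finprod N (\<lambda>i. Some (ps ! i) [^]\<^bsub>N\<^esub> vec_index z i) I = Some u" for I u
    using that
  proof (induction I arbitrary: u rule: finite_induct)
    case empty
    then show ?case using h0 by (simp add: one_N)
  next
    case (insert i I)
    let ?f = "\<lambda>i. Some (ps ! i) [^]\<^bsub>N\<^esub> vec_index z i"
    have f: "?f \<in> I \<rightarrow> carrier N" "?f i \<in> carrier N"
      using insert.prems by (auto intro!: N.nat_pow_closed atom_carrier)
    have prod: "?f i \<otimes>\<^bsub>N\<^esub> finprod N ?f I = Some u"
      using insert f by simp
    then obtain a b where ab: "?f i = Some a" "finprod N ?f I = Some b"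
      by (rule mult_N_eq_SomeD)
    moreover have "a < m" "b < m"
      using f N.finprod_closed[OF f(1)] by (auto intro!: lt simp flip: ab)
    moreover have "h a = real (vec_index z i) * h (ps ! i)"
      using pow[OF ab(1)] atom_lt(1)[of i] insert.prems by simp
    ultimately show ?case
      using insert prod mult[of a b u] by simp
  qed
  then show ?thesis
    using assms(2) unfolding weight_def factor_hom_def by blast
qed

text \<open>A nonzero non-atom is a sum of two elements of smaller height.\<close>
lemma phi_surj:
  assumes "u < m"
  obtains z where "z \<in> carrier_vec k" "\<phi> z = Some u"
proof -
  obtain f where f: "additive f" "\<And>u. 0 < u \<Longrightarrow> u < m \<Longrightarrow> f u > 0"
    by (rule exists_height) blast
  \<comment> \<open>Heights are real, so the induction counts the elements of smaller height
    instead.\<close>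
  have "\<exists>z\<in>carrier_vec k. \<phi> z = Some u"
    using assms
  proof (induction "card {v \<in> {..<m}. f v < f u}" arbitrary: u rule: less_induct)
    case less
    have IH: "\<exists>z\<in>carrier_vec k. \<phi> z = Some v" if "v < m" "f v < f u" for v
      using that by (intro less.hyps psubset_card_mono) auto
    show ?case
    proof (cases "u = 0 \<or> u \<in> kunz_atoms m e F")
      case True
      then show ?thesis
      proof
        assume "u = 0"
        then show ?thesis using phi_zero by (intro bexI[of _ "0\<^sub>v k"]) auto
      next
        assume "u \<in> kunz_atoms m e F"
        then obtain i where "i < k" "ps ! i = u" using set_ps by (metis in_set_conv_nth)
        then show ?thesis using phi_unit_vec by (intro bexI[of _ "unit_vec k i"]) auto
      qed
    next
      case False
      then have "kunz_less m e F 0 u"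
        using less.prems by (simp add: kunz_less_def kunz_le_def)
      then obtain c where c: "kunz_less m e F 0 c" "kunz_less m e F c u"
        using False unfolding kunz_atoms_def by blast
      define d where "d = (u + m - c) mod m"
      have lt: "0 < c" "c < m" "d < m"
        using c m_ge_2 by (auto simp: kunz_less_def kunz_le_def d_def)
      have sum: "(c + d) mod m = u" unfolding d_def using lt less.prems by (intro diff_mod) auto
      have c0: "c \<noteq> 0" and "c \<noteq> u" using lt c(2) by (auto simp: kunz_less_def)
      then have d0: "d \<noteq> 0" using sum lt by (cases "d = 0") auto
      have tight: "tight c d"
        using c(2) c0 \<open>c \<noteq> u\<close>
        unfolding tight_def sum kunz_less_def kunz_le_def d_def[symmetric] by blast
      then have "f c + f d = f u" using additiveD[OF f(1), of c d] lt sum by simp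
      moreover have "f c > 0" "f d > 0" using f(2) lt d0 by auto
      ultimately obtain z w where "z \<in> carrier_vec k" "\<phi> z = Some c" "w \<in> carrier_vec k" "\<phi> w = Some d"
        using IH[of c] IH[of d] lt by force
      then show ?thesis
        using tight sum by (intro bexI[of _ "z + w"]) (auto simp: phi_add mult_N kunz_oplus_Some simp del: kunz_oplus.simps(1))
    qed
  qed
  then show ?thesis using that by blast
qed

section \<open>Presentations and the kernel of the presentation matrix\<close>

lemma weight_eq_of_congruence:
  assumes pres: "is_presentation m e F ps \<rho>"
    and eq: "\<And>z z'. (z, z') \<in> \<rho> \<Longrightarrow> weight v z = weight v z'"
    and ker: "(z, z') \<in> factor_ker m e F ps" and "\<phi> z \<noteq> None"
  shows "weight v z = weight v z'"
proof -
  \<comment> \<open>Admitting all kernel pairs that map to infinity lets \<open>C\<close> contain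
    the generators deleted in passing from \<open>R\<close> to \<open>\<rho>\<close>. Translation
    preserves \<open>C\<close>, since infinity absorbs and weights add.\<close>
  define C where "C = {(z, z') \<in> factor_ker m e F ps. \<phi> z = None \<or> weight v z = weight v z'}"
  obtain R where R: "R \<subseteq> factor_ker m e F ps" "generated_congruence k R = factor_ker m e F ps"
      "\<rho> = {(z, z') \<in> R. \<phi> z \<noteq> None}"
    using pres by (auto simp: is_presentation_def)
  have "(z + w, z' + w) \<in> C" if "(z, z') \<in> C" "w \<in> carrier_vec k" for z z' w
  proof -
    have zz: "z \<in> carrier_vec k" "z' \<in> carrier_vec k" "\<phi> z = \<phi> z'" "\<phi> z = None \<or> weight v z = weight v z'"
      using that(1) by (auto simp: C_def factor_ker_def)
    then show ?thesis
      using that(2) by (auto simp: C_def factor_ker_def phi_add weight_add mult_N)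
  qed
  moreover have "equiv (carrier_vec k) C"
    by (rule equivI) (auto simp: C_def factor_ker_def refl_on_def sym_def trans_def)
  ultimately have "is_congruence k C"
    by (auto simp: is_congruence_def)
  moreover have "R \<subseteq> C"
  proof clarify
    fix z z' assume mem: "(z, z') \<in> R"
    then have "\<phi> z = None \<or> weight v z = weight v z'" using eq[of z z'] R(3) by blast
    then show "(z, z') \<in> C" using mem R(1) by (auto simp: C_def)
  qed
  ultimately have "factor_ker m e F ps \<subseteq> C"
    unfolding R(2)[symmetric] generated_congruence_def by blast
  then show ?thesis using ker \<open>\<phi> z \<noteq> None\<close> by (auto simp: C_def)
qed

text \<open>The product of a row with \<open>v\<close> is the difference of the weights of the two
  exponent vectors in the corresponding pair.\<close>

lemma mat_kernel_presentation_matrix: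
  assumes "set rs \<subseteq> carrier_vec k \<times> carrier_vec k"
  shows "v \<in> mat_kernel (map_mat real_of_int (presentation_matrix k rs)) \<longleftrightarrow>
    v \<in> carrier_vec k \<and> (\<forall>(z, z') \<in> set rs. weight (vec_index v) z = weight (vec_index v) z')"
proof -
  define A where "A = map_mat real_of_int (presentation_matrix k rs)"
  have A: "A \<in> carrier_mat (length rs) k"
    by (simp add: A_def presentation_matrix_def)
  have row: "vec_index (A *\<^sub>v v) i
      = weight (vec_index v) (fst (rs ! i)) - weight (vec_index v) (snd (rs ! i))"
    if "i < length rs" "v \<in> carrier_vec k" for i
    using that A
    by (simp add: A_def presentation_matrix_def weight_def scalar_prod_def lessThan_atLeast0
        sum_subtractf[symmetric] left_diff_distrib)
  have "A *\<^sub>v v = 0\<^sub>v (length rs) \<longleftrightarrow>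
      (\<forall>i<length rs. weight (vec_index v) (fst (rs ! i)) = weight (vec_index v) (snd (rs ! i)))"
    if "v \<in> carrier_vec k"
    using row[OF _ that] A by (auto simp: vec_eq_iff)
  then show ?thesis
    unfolding A_def[symmetric] mat_kernel[OF A] by (auto simp: all_set_conv_all_nth split_beta)
qed

definition atom_coords :: "real ^ 'n \<Rightarrow> real Matrix.vec" where
  "atom_coords d = Matrix.vec k (\<lambda>i. gcoord e d (ps ! i))"

lemma weight_atom_coords: "weight (vec_index (atom_coords d)) z = weight (\<lambda>i. gcoord e d (ps ! i)) z"
  by (simp add: weight_def atom_coords_def)

lemma gcoord_eqI:
  assumes "\<And>u. u < m \<Longrightarrow> gcoord e x u = gcoord e y u"
  shows "x = y"
proof -
  have "x $ j = y $ j" for j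
  proof -
    obtain u where "u \<in> {1..<m}" "e u = j"
      using bij_e by (metis UNIV_I bij_betw_def imageE)
    then show ?thesis using assms[of u] by (simp add: gcoord_def)
  qed
  then show ?thesis by (simp add: Finite_Cartesian_Product.vec_eq_iff)
qed

text \<open>Every element has a factorization, so an additive function is determined by its values
  at the atoms. Conversely, a kernel vector gives all factorizations of an element the same weight,
  which defines an additive function.\<close>

lemma bij_atom_coords:
  assumes pres: "is_presentation m e F ps \<rho>" and rs: "set rs = \<rho>"
  shows "bij_betw atom_coords directions (mat_kernel (map_mat real_of_int (presentation_matrix k rs)))"
proof -
  have \<rho>: "\<rho> \<subseteq> factor_ker m e F ps" "\<And>z z'. (z, z') \<in> \<rho> \<Longrightarrow> \<phi> z \<noteq> None"
    using pres by (auto simp: is_presentation_def)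
  have "set rs \<subseteq> carrier_vec k \<times> carrier_vec k"
    using \<rho>(1) rs by (auto simp: factor_ker_def)
  note kernel = mat_kernel_presentation_matrix[OF this]
  show ?thesis
    unfolding bij_betw_def
  proof (intro conjI equalityI subsetI)
    show "inj_on atom_coords directions"
    proof (rule inj_onI, rule gcoord_eqI)
      fix x y u assume x: "x \<in> directions" and y: "y \<in> directions"
        and eq: "atom_coords x = atom_coords y" and "u < m"
      obtain z where z: "\<phi> z = Some u" using phi_surj[OF \<open>u < m\<close>] by blast
      have "gcoord e x u = weight (vec_index (atom_coords x)) z"
        "gcoord e y u = weight (vec_index (atom_coords y)) z"
        using x y phi_additive[OF _ z] by (auto simp: weight_atom_coords directions_def)
      then show "gcoord e x u = gcoord e y u" using eq by simp
    qed
  next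
    fix v assume "v \<in> atom_coords ` directions"
    then obtain d where d: "additive (gcoord e d)" "v = atom_coords d"
      by (auto simp: directions_def)
    have "weight (vec_index v) z = weight (vec_index v) z'" if mem: "(z, z') \<in> \<rho>" for z z'
    proof -
      obtain u where "\<phi> z = Some u" using \<rho>(2)[OF mem] by blast
      moreover have "\<phi> z = \<phi> z'" using \<rho>(1) mem by (auto simp: factor_ker_def)
      ultimately show ?thesis
        using phi_additive[OF d(1), of z u] phi_additive[OF d(1), of z' u] by (simp add: d(2) weight_atom_coords)
    qed
    then show "v \<in> mat_kernel (map_mat real_of_int (presentation_matrix k rs))"
      by (auto simp: kernel rs d(2) atom_coords_def)
  next
    fix v assume "v \<in> mat_kernel (map_mat real_of_int (presentation_matrix k rs))"
    then have v: "v \<in> carrier_vec k"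
        "\<And>z z'. (z, z') \<in> \<rho> \<Longrightarrow> weight (vec_index v) z = weight (vec_index v) z'"
      by (auto simp: kernel rs)
    obtain Z where Z: "\<And>u. u < m \<Longrightarrow> Z u \<in> carrier_vec k \<and> \<phi> (Z u) = Some u"
    proof -
      have "\<forall>u. \<exists>z. u < m \<longrightarrow> z \<in> carrier_vec k \<and> \<phi> z = Some u"
        using phi_surj by blast
      then show ?thesis using that by metis
    qed
    define h where "h u = weight (vec_index v) (Z u)" for u
    \<comment> \<open>Independence of the chosen factorization \<open>Z u\<close>: any other
      factorization of \<open>u\<close> forms a kernel pair with it, and its value is
      finite.\<close>
    have h: "weight (vec_index v) z = h u" if "z \<in> carrier_vec k" "\<phi> z = Some u" for z u
      unfolding h_def using that Z[OF phi_lt[OF that(2)]]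
      by (intro weight_eq_of_congruence[OF pres v(2)]) (auto simp: factor_ker_def)
    have h0: "h 0 = 0" using h[of "0\<^sub>v k" 0] phi_zero weight_zero by simp
    have add: "additive h"
      unfolding additive_def
    proof (intro allI impI)
      fix a b assume ab: "a < m" "b < m" "tight a b"
      \<comment> \<open>For a tight pair, adding the chosen factorizations gives a factorization of
        the sum, usually not the chosen one.\<close>
      then have "\<phi> (Z a + Z b) = Some ((a + b) mod m)"
        using Z by (simp add: phi_add mult_N kunz_oplus_Some del: kunz_oplus.simps(1))
      then have "weight (vec_index v) (Z a + Z b) = h ((a + b) mod m)"
        using Z ab by (intro h) auto
      then show "h a + h b = h ((a + b) mod m)"
        using Z ab by (simp add: weight_add h_def)
    qed
    \<comment> \<open>The vector with coordinate function \<open>h\<close>; at index 0 the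
      convention agrees because \<open>h 0 = 0\<close>.\<close>
    define d :: "real ^ 'n" where "d = (\<chi> j. h (inv_into {1..<m} e j))"
    have d: "gcoord e d u = h u" if "u < m" for u
      using that bij_e h0 by (auto simp: gcoord_def d_def bij_betw_def)
    have "additive (gcoord e d)"
      using add d m_ge_2 by (auto simp: additive_def)
    moreover have "v = atom_coords d"
    proof (rule eq_vecI)
      fix i assume "i < dim_vec (atom_coords d)"
      then have i: "i < k" by (simp add: atom_coords_def)
      have "vec_index v i = h (ps ! i)"
        using h[OF _ phi_unit_vec[OF i]] weight_unit_vec[OF i] by simp
      then show "vec_index v i = vec_index (atom_coords d) i"
        using i atom_lt(1)[OF i] by (simp add: atom_coords_def d)
    qed (use v(1) in \<open>simp add: atom_coords_def\<close>)
    ultimately show "v \<in> atom_coords ` directions" by (auto simp: directions_def)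
  qed
qed

end

theorem theorem4p3:
  fixes m k :: nat
    and e :: "nat \<Rightarrow> 'n :: finite"
    and F :: "(real ^ 'n) set"
    and ps :: "nat list"
    and \<rho> :: "(nat Matrix.vec \<times> nat Matrix.vec) set"
    and rs :: "(nat Matrix.vec \<times> nat Matrix.vec) list"
  assumes "m \<ge> 2"
    and "bij_betw e {1..<m} (UNIV :: 'n set)"
    and "is_kunz_face m e F"
    and "kunz_subgroup m e F = {0}"
    and "k = card (kunz_atoms m e F)"
    and "distinct ps" and "set ps = kunz_atoms m e F"
    and "finite \<rho>" and "is_presentation m e F ps \<rho>"
    and "distinct rs" and "set rs = \<rho>"
  shows "aff_dim F = int k - int (int_mat_rank (presentation_matrix k rs))"
proof -
  interpret kunz_factorizations m e F ps
    using assms by unfold_locales auto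
  have k: "k = length ps"
    using assms(5-7) distinct_card by metis
  define A where "A = map_mat real_of_int (presentation_matrix k rs)"
  have A: "A \<in> carrier_mat (length rs) k"
    by (simp add: A_def presentation_matrix_def)
  have "kernel_dim A = Real_Vector_Spaces.dim directions"
  proof (rule kernel_dim_eq_dim[OF A subspace_directions])
    show "bij_betw atom_coords directions (mat_kernel A)"
      unfolding A_def k using assms by (intro bij_atom_coords) auto
  qed (auto simp: atom_coords_def gcoord_add gcoord_scaleR)
  moreover have "int_mat_rank (presentation_matrix k rs) = vec_space.rank (length rs) A"
    by (simp add: int_mat_rank_def A_def presentation_matrix_def)
  ultimately show ?thesis
    using rank_add_kernel_dim[OF A] aff_dim_face by simp
qed

end
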